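(* Let $\Omega$ be an infinite set, let $$\mathcal{B}=\Big\{\prod_{\alpha\in\Omega}\Sigma_\alpha : |\{\alpha\in\Omega : \beta\notin\Sigma_\alpha\}|<|\Omega| \text{ for all } \beta\in\Omega\Big\},$$ where $\{\Sigma_\alpha : \alpha\in\Omega\}$ ranges over families of subsets of $\Omega$ indexed by $\Omega$, and let $\mathcal{T}=\langle\mathcal{B}\rangle$ denote the topology on $\Omega^\Omega$ generated by $\mathcal{B}$. Then the following hold. (1) $\mathcal{B}$ is closed under finite intersections, and in particular is a base for $\mathcal{T}$. (2) Any base for $\mathcal{T}$ must have strictly more than $|\Omega|$ elements. (3) $\mathcal{T}$ strictly contains the pointwise topology. In particular, $\mathcal{T}$ is Hausdorff. (4) $\mathcal{T}$ is perfect. (5) There is a subset of $\Omega^\Omega$ of cardinality $\big|\sum_{\kappa<|\Omega|}|\Omega|^\kappa\big|$ (the sum being over cardinals $\kappa<|\Omega|$) that is dense in $\mathcal{T}$. In particular, if $\Omega$ is countable, then $\mathcal{T}$ is separable. (6) No nonempty element of $\mathcal{B}$ is contained in a compact (with respect to $\mathcal{T}$) subset of $\Omega^\Omega$. (7) If $|\Omega|$ is regular, then $\Omega^\Omega$ is a topological semigroup with respect to $\mathcal{T}$.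
   Context: $\Omega^\Omega$ is the monoid of all functions $\Omega\to\Omega$ under composition, with functions written on the right. For subsets $\Sigma_\alpha\subseteq\Omega$ ($\alpha\in\Omega$), $\prod_{\alpha\in\Omega}\Sigma_\alpha$ is identified with $\{f\in\Omega^\Omega : (\alpha)f\in\Sigma_\alpha \text{ for all }\alpha\in\Omega\}$. The pointwise topology on $\Omega^\Omega$ is the product topology on $\prod_\Omega\Omega$ with each factor $\Omega$ discrete. A topology is perfect if it has no isolated points. A semigroup $S$ with a topology is a topological semigroup if multiplication $S\times S\to S$ is continuous for the product topology on $S\times S$. A cardinal is regular if it equals its cofinality. *)

theory Defs
  imports "HOL-Analysis.Analysis"
begin

unbundle cardinal_syntax

text \<open>
  The set \<open>\<Omega>\<close> is the universe of the type \<open>'a\<close>, so \<open>\<Omega>\<^sup>\<Omega>\<close> is the type \<open>'a \<Rightarrow> 'a\<close>.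
\<close>

definition full_prod :: "('a \<Rightarrow> 'a set) \<Rightarrow> ('a \<Rightarrow> 'a) set" where
  "full_prod \<Sigma> = {f. \<forall>\<alpha>. f \<alpha> \<in> \<Sigma> \<alpha>}"

definition cosmall_prods :: "('a \<Rightarrow> 'a) set set" where
  "cosmall_prods = {full_prod \<Sigma> | \<Sigma>. \<forall>\<beta>. |{\<alpha>. \<beta> \<notin> \<Sigma> \<alpha>}| <o |UNIV :: 'a set| }"

definition cosmall_top :: "('a \<Rightarrow> 'a) topology" where
  "cosmall_top = topology_generated_by cosmall_prods"

definition pointwise_top :: "('a \<Rightarrow> 'a) topology" where
  "pointwise_top = product_topology (\<lambda>_. discrete_topology UNIV) UNIV"

definition is_base :: "'b topology \<Rightarrow> 'b set set \<Rightarrow> bool" where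
  "is_base X \<B> \<longleftrightarrow>
     (\<forall>U\<in>\<B>. openin X U) \<and> (\<forall>U. openin X U \<longrightarrow> (\<exists>\<U>\<subseteq>\<B>. U = \<Union>\<U>))"

definition perfect_topology :: "'b topology \<Rightarrow> bool" where
  "perfect_topology X \<longleftrightarrow> \<not> (\<exists>x\<in>topspace X. openin X {x})"

definition topological_semigroup :: "'b topology \<Rightarrow> ('b \<Rightarrow> 'b \<Rightarrow> 'b) \<Rightarrow> bool" where
  "topological_semigroup X mul \<longleftrightarrow>
     (\<forall>x\<in>topspace X. \<forall>y\<in>topspace X. mul x y \<in> topspace X) \<and>
     (\<forall>x\<in>topspace X. \<forall>y\<in>topspace X. \<forall>z\<in>topspace X.
        mul (mul x y) z = mul x (mul y z)) \<and>
     continuous_map (prod_topology X X) X (\<lambda>(x, y). mul x y)"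

text \<open>Functions are written on the right, so the product \<open>fg\<close> applies \<open>f\<close> first.\<close>

definition right_comp :: "('a \<Rightarrow> 'a) \<Rightarrow> ('a \<Rightarrow> 'a) \<Rightarrow> ('a \<Rightarrow> 'a)" where
  "right_comp f g = g \<circ> f"

text \<open>
  Each cardinal \<open>\<kappa> < |\<Omega>|\<close> is represented exactly once, by the class of all subsets of
  \<open>\<Omega>\<close> of cardinality \<open>\<kappa>\<close>.
\<close>

definition cardinals_below :: "'a set set set" where
  "cardinals_below = {A :: 'a set. |A| <o |UNIV :: 'a set| } // {(A, B). |A| =o |B| }"

text \<open>
  The cardinal sum of \<open>|\<Omega>|\<^sup>\<kappa>\<close> over all cardinals \<open>\<kappa> < |\<Omega>|\<close>; the choice of a representative
  of the class \<open>\<kappa>\<close> does not affect the cardinality.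
\<close>

definition sum_of_powers :: "('a set set \<times> ('a \<Rightarrow> 'a)) rel" where
  "sum_of_powers =
     BNF_Cardinal_Arithmetic.Csum |cardinals_below :: 'a set set set|
       (\<lambda>\<kappa>. |UNIV :: 'a set| ^c |SOME A. A \<in> \<kappa>| )"

end

theory Submission
  imports Defs "HOL-Library.Countable_Set_Type"
begin

text \<open>Call a set small if its cardinality is below |\<Omega>|. A member of the base is a
  product in which each value is forbidden at only few coordinates, and a function in it may be
  altered at any coordinate to any value permitted there. Finite unions of small sets are small, so
  the base is closed under finite intersections. Evaluation sets \<open>{f. f x \<in> U}\<close> are
  basic, so the topology refines the pointwise one.

  Strictness, the size of bases and the failure of compactness rest on one device. For injective
  \<open>\<gamma>\<close>, \<open>avoiding \<gamma>\<close> is basic, since the value \<alpha> is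
  forbidden only at \<open>\<gamma> \<alpha>\<close>. As \<Omega> is equinumerous with its square,
  \<open>cosmall_transversal\<close> picks \<open>\<gamma> \<alpha>\<close> injectively from
  prescribed sets with small complement. Hence \<open>avoiding \<gamma>\<close> can be made to
  contain none of at most |\<Omega>| given nonempty open sets (\<open>base_card_gt\<close>), and
  together with the sets \<open>{f. f (\<gamma> \<alpha>) = \<alpha>}\<close> it can form an open
  cover from which no finite subfamily covers a given nonempty basic set
  (\<open>basic_not_in_compact\<close>).

  Functions constant off a small set are dense (\<open>small_support_dense\<close>) and are counted
  by their supports and the values there (\<open>small_support_card_le\<close>). Continuity of
  composition (\<open>comp_neighbourhoods\<close>) uses that for regular |\<Omega>| a union of few
  small sets is small.\<close>

abbreviation small :: "'a set \<Rightarrow> bool" where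
  "small A \<equiv> |A| <o |UNIV :: 'a set|"

text \<open>The complement is the union of the sets
  \<open>{f. f (\<gamma> \<alpha>) = \<alpha>}\<close>, which are open too; this is what yields a
  cover of the whole space.\<close>

definition avoiding :: "('a \<Rightarrow> 'a) \<Rightarrow> ('a \<Rightarrow> 'a) set" where
  "avoiding \<gamma> = {f. \<forall>\<alpha>. f (\<gamma> \<alpha>) \<noteq> \<alpha>}"

lemma small_subset: "small B \<Longrightarrow> A \<subseteq> B \<Longrightarrow> small A"
  using card_of_mono1 ordLeq_ordLess_trans by blast

lemma small_image: "small A \<Longrightarrow> small (f ` A)" for f :: "'a \<Rightarrow> 'a"
  by (rule ordLeq_ordLess_trans[OF card_of_image])

lemma small_Compl_inj:
  fixes f :: "'a \<Rightarrow> 'a"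
  assumes "small (- S)" and "inj f"
  shows "\<exists>x. f x \<in> S"
proof (rule ccontr)
  assume "\<nexists>x. f x \<in> S"
  then have "|UNIV :: 'a set| \<le>o |- S|"
    by (intro card_of_ordLeqI[OF assms(2)]) auto
  then show False
    using assms(1) not_ordLess_ordLeq by blast
qed

lemma cosmall_prodsI:
  "U = full_prod \<Sigma> \<Longrightarrow> (\<And>\<beta>. small {\<alpha>. \<beta> \<notin> \<Sigma> \<alpha>}) \<Longrightarrow> U \<in> cosmall_prods"
  unfolding cosmall_prods_def by blast

lemma cosmall_prodsE:
  assumes "U \<in> cosmall_prods"
  obtains \<Sigma> where "U = full_prod \<Sigma>" "\<And>\<beta>. small {\<alpha>. \<beta> \<notin> \<Sigma> \<alpha>}"
  using assms unfolding cosmall_prods_def by blast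

lemma openin_cosmall_prods: "U \<in> cosmall_prods \<Longrightarrow> openin cosmall_top U"
  unfolding cosmall_top_def by (rule topology_generated_by_Basis)

section \<open>Cardinals below |\<Omega>| and the sum of powers\<close>

definition card_class :: "'a set \<Rightarrow> 'a set set" where
  "card_class A = {B. |A| =o |B| }"

lemma cardinals_below_eq: "cardinals_below = card_class ` {A :: 'a set. small A}"
  by (auto simp: cardinals_below_def quotient_def card_class_def)

lemma card_class_some: "|A| =o |SOME B. B \<in> card_class A|"
proof -
  have "A \<in> card_class A"
    by (simp add: card_class_def card_of_refl)
  then show ?thesis
    by (metis (no_types, lifting) card_class_def mem_Collect_eq someI_ex)
qed

lemma card_class_eq_iff: "card_class A = card_class B \<longleftrightarrow> |A| =o |B|"
  by (auto simp: card_class_def card_of_refl intro: ordIso_symmetric ordIso_transitive)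

lemma sum_of_powers_eq:
  "(sum_of_powers :: ('a set set \<times> ('a \<Rightarrow> 'a)) rel) =
     |SIGMA \<kappa> : cardinals_below. Func (SOME A. A \<in> \<kappa>) UNIV|"
  by (simp add: sum_of_powers_def Csum_def cexp_def Field_card_of)

context
  assumes inf: "infinite (UNIV :: 'a set)"
begin

section \<open>Small sets, transversals and avoiding sets\<close>

lemma small_finite: "finite A \<Longrightarrow> small (A :: 'a set)"
  using inf finite_ordLess_infinite[of "|A|" "|UNIV :: 'a set|"]
  by (simp add: card_of_well_order_on Field_card_of)

lemma small_Un: "small A \<Longrightarrow> small B \<Longrightarrow> small (A \<union> B :: 'a set)"
  using inf by (rule card_of_Un_ordLess_infinite)

lemma not_small_UNIV: "\<not> small (UNIV :: 'a set)"
  using ordLess_irreflexive by blast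

lemma two_points: "\<exists>a b :: 'a. a \<noteq> b"
  using inf by (metis (full_types) UNIV_eq_I finite.simps insertI1)

lemma inj_pairing: "\<exists>p :: 'a \<times> 'a \<Rightarrow> 'a. inj p"
  using card_of_Times_same_infinite[OF inf] card_of_ordIso[of "UNIV \<times> UNIV" UNIV]
  by (auto simp: bij_betw_def)

text \<open>
  An injective pairing \<open>p\<close> partitions \<open>\<Omega>\<close> into \<open>|\<Omega>|\<close> rows of size \<open>|\<Omega>|\<close>; row \<open>\<alpha>\<close> meets \<open>S \<alpha>\<close>,
  so no transfinite recursion is needed.
\<close>

lemma cosmall_transversal:
  fixes S :: "'a \<Rightarrow> 'a set"
  assumes "\<And>\<alpha>. small (- S \<alpha>)"
  obtains \<gamma> where "inj \<gamma>" "\<And>\<alpha>. \<gamma> \<alpha> \<in> S \<alpha>"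
proof -
  obtain p :: "'a \<times> 'a \<Rightarrow> 'a" where p: "inj p"
    using inj_pairing by blast
  have "inj (\<lambda>\<beta>. p (\<alpha>, \<beta>))" for \<alpha>
    by (rule injI) (drule injD[OF p], simp)
  then have "\<exists>\<beta>. p (\<alpha>, \<beta>) \<in> S \<alpha>" for \<alpha>
    by (rule small_Compl_inj[OF assms])
  then obtain b where "\<And>\<alpha>. p (\<alpha>, b \<alpha>) \<in> S \<alpha>"
    by metis
  moreover have "inj (\<lambda>\<alpha>. p (\<alpha>, b \<alpha>))"
    by (rule injI) (drule injD[OF p], simp)
  ultimately show thesis
    using that by blast
qed

lemma avoiding_in_cosmall_prods:
  fixes \<gamma> :: "'a \<Rightarrow> 'a"
  assumes "inj \<gamma>"
  shows "avoiding \<gamma> \<in> cosmall_prods"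
proof (rule cosmall_prodsI)
  show "avoiding \<gamma> = full_prod (\<lambda>x. {y. \<forall>\<alpha>. x = \<gamma> \<alpha> \<longrightarrow> y \<noteq> \<alpha>})"
    by (auto simp: avoiding_def full_prod_def)
  show "small {x. \<beta> \<notin> {y. \<forall>\<alpha>. x = \<gamma> \<alpha> \<longrightarrow> y \<noteq> \<alpha>}}" for \<beta>
    by (rule small_subset[OF small_finite[of "{\<gamma> \<beta>}"]]) auto
qed

lemma avoiding_nonempty:
  fixes \<gamma> :: "'a \<Rightarrow> 'a"
  assumes "inj \<gamma>"
  shows "avoiding \<gamma> \<noteq> {}"
proof -
  have "\<exists>f :: 'a \<Rightarrow> 'a. \<forall>\<alpha>. f \<alpha> \<noteq> \<alpha>"
    using two_points by (intro choice allI) metis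
  then obtain f :: "'a \<Rightarrow> 'a" where "\<forall>\<alpha>. f \<alpha> \<noteq> \<alpha>" ..
  \<comment> \<open>At \<open>\<gamma> \<alpha>\<close> this takes the value
    \<open>f \<alpha>\<close>, and \<open>f\<close> has no fixed point.\<close>
  then have "f \<circ> inv \<gamma> \<in> avoiding \<gamma>"
    using assms by (simp add: avoiding_def)
  then show ?thesis
    by blast
qed

section \<open>The base and its neighbourhoods\<close>

lemma UNIV_in_cosmall_prods: "(UNIV :: ('a \<Rightarrow> 'a) set) \<in> cosmall_prods"
  by (rule cosmall_prodsI[of _ "\<lambda>_. UNIV"]) (auto simp: full_prod_def small_finite)

lemma evaluation_in_cosmall_prods: "{f :: 'a \<Rightarrow> 'a. f x \<in> U} \<in> cosmall_prods"
proof (rule cosmall_prodsI)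
  show "{f. f x \<in> U} = full_prod (\<lambda>\<alpha>. if \<alpha> = x then U else UNIV)"
    by (auto simp: full_prod_def)
  show "small {\<alpha>. \<beta> \<notin> (if \<alpha> = x then U else UNIV)}" for \<beta>
    by (rule small_subset[OF small_finite[of "{x}"]]) auto
qed

lemma cosmall_prods_Int:
  fixes U V :: "('a \<Rightarrow> 'a) set"
  assumes "U \<in> cosmall_prods" "V \<in> cosmall_prods"
  shows "U \<inter> V \<in> cosmall_prods"
proof -
  obtain \<Sigma> \<Gamma> where U: "U = full_prod \<Sigma>" "\<And>\<beta>. small {\<alpha>. \<beta> \<notin> \<Sigma> \<alpha>}"
    and V: "V = full_prod \<Gamma>" "\<And>\<beta>. small {\<alpha>. \<beta> \<notin> \<Gamma> \<alpha>}"
    using assms by (metis cosmall_prodsE)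
  show ?thesis
  proof (rule cosmall_prodsI)
    show "U \<inter> V = full_prod (\<lambda>\<alpha>. \<Sigma> \<alpha> \<inter> \<Gamma> \<alpha>)"
      by (auto simp: U V full_prod_def)
    show "small {\<alpha>. \<beta> \<notin> \<Sigma> \<alpha> \<inter> \<Gamma> \<alpha>}" for \<beta>
      by (rule small_subset[OF small_Un[OF U(2)[of \<beta>] V(2)[of \<beta>]]]) auto
  qed
qed

lemma cosmall_prods_Inter:
  fixes \<F> :: "('a \<Rightarrow> 'a) set set"
  assumes "finite \<F>" "\<F> \<subseteq> cosmall_prods"
  shows "\<Inter>\<F> \<in> cosmall_prods"
  using assms by (induction) (auto simp: UNIV_in_cosmall_prods cosmall_prods_Int)

lemma topspace_cosmall_top: "topspace (cosmall_top :: ('a \<Rightarrow> 'a) topology) = UNIV"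
  using openin_subset[OF openin_cosmall_prods[OF UNIV_in_cosmall_prods]] by blast

text \<open>Induction on the generation of open sets; the intersection case is closure of the base
  under binary intersections.\<close>

lemma openin_cosmall_top_basic:
  fixes U :: "('a \<Rightarrow> 'a) set"
  assumes "openin cosmall_top U" "f \<in> U"
  obtains \<Sigma> where "\<And>\<beta>. small {\<alpha>. \<beta> \<notin> \<Sigma> \<alpha>}" "f \<in> full_prod \<Sigma>" "full_prod \<Sigma> \<subseteq> U"
proof -
  have "generate_topology_on cosmall_prods U"
    using assms(1) by (simp add: cosmall_top_def openin_topology_generated_by_iff)
  then have "\<exists>B\<in>cosmall_prods. f \<in> B \<and> B \<subseteq> U"
    using assms(2)
  proof induction
    case (Int a b)
    then obtain A B where "A \<in> cosmall_prods" "B \<in> cosmall_prods" "f \<in> A" "f \<in> B" "A \<subseteq> a" "B \<subseteq> b"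
      by blast
    then show ?case
      using cosmall_prods_Int by (intro bexI[of _ "A \<inter> B"]) auto
  next
    case (UN K)
    then obtain k B where "k \<in> K" "B \<in> cosmall_prods" "f \<in> B" "B \<subseteq> k"
      by (metis UnionE)
    then show ?case
      by (intro bexI[of _ B]) auto
  qed auto
  then show thesis
    using that by (auto elim!: cosmall_prodsE)
qed

lemma is_base_cosmall_prods: "is_base (cosmall_top :: ('a \<Rightarrow> 'a) topology) cosmall_prods"
  unfolding is_base_def
proof (intro conjI ballI allI impI)
  fix U :: "('a \<Rightarrow> 'a) set"
  assume U: "openin cosmall_top U"
  have "\<exists>B\<in>cosmall_prods. f \<in> B \<and> B \<subseteq> U" if "f \<in> U" for f
    by (rule openin_cosmall_top_basic[OF U that]) (use cosmall_prodsI in blast)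
  then have "U = \<Union>{B \<in> cosmall_prods. B \<subseteq> U}"
    by blast
  then show "\<exists>\<U>\<subseteq>cosmall_prods. U = \<Union>\<U>"
    by (intro exI[of _ "{B \<in> cosmall_prods. B \<subseteq> U}"]) simp
qed (rule openin_cosmall_prods)

section \<open>Size of bases\<close>

text \<open>
  Diagonalisation: given open sets indexed by \<open>\<Omega>\<close>, pick \<open>\<gamma> \<alpha>\<close> such that the \<open>\<alpha>\<close>-th set contains
  some \<open>f\<close> with \<open>f (\<gamma> \<alpha>) = \<alpha>\<close>; then none of them lies inside \<open>avoiding \<gamma>\<close>.
\<close>

lemma base_card_gt:
  assumes base: "is_base (cosmall_top :: ('a \<Rightarrow> 'a) topology) \<C>"
  shows "|UNIV :: 'a set| <o |\<C>|"
proof (rule ccontr)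
  assume "\<not> |UNIV :: 'a set| <o |\<C>|"
  then have "|\<C>| \<le>o |UNIV :: 'a set|"
    using not_ordLess_iff_ordLeq[OF card_of_Well_order card_of_Well_order] by (rule iffD1[rotated])
  then obtain e where e: "inj_on e \<C>" "e ` \<C> \<subseteq> (UNIV :: 'a set)"
    using card_of_ordLeq[of \<C> "UNIV :: 'a set"] by blast
  \<comment> \<open>\<open>S\<close> consists of the coordinates at which some basic product inside
    the member \<open>U\<close> of index \<alpha> permits the value \<alpha>; if no nonempty member
    has this index, \<open>UNIV\<close> serves.\<close>
  have "\<exists>S. small (- S) \<and> (\<forall>U\<in>\<C>. U \<noteq> {} \<and> e U = \<alpha> \<longrightarrow> (\<forall>x\<in>S. \<exists>f\<in>U. f x = \<alpha>))" for \<alpha>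
  proof (cases "\<exists>U\<in>\<C>. U \<noteq> {} \<and> e U = \<alpha>")
    case True
    then obtain U where U: "U \<in> \<C>" "U \<noteq> {}" "e U = \<alpha>"
      by blast
    then obtain f where "f \<in> U"
      by blast
    have "openin cosmall_top U"
      using base U by (simp add: is_base_def)
    then obtain \<Sigma> where \<Sigma>: "\<And>\<beta>. small {\<alpha>. \<beta> \<notin> \<Sigma> \<alpha>}" "f \<in> full_prod \<Sigma>" "full_prod \<Sigma> \<subseteq> U"
      using \<open>f \<in> U\<close> by (rule openin_cosmall_top_basic) (rule that)
    have "\<exists>f\<in>U. f x = \<alpha>" if "\<alpha> \<in> \<Sigma> x" for x
      using \<Sigma> that by (intro bexI[of _ "f(x := \<alpha>)"]) (auto simp: full_prod_def)
    moreover have "V = U" if "V \<in> \<C>" "e V = \<alpha>" for V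
      using e U that by (auto simp: inj_on_def)
    ultimately show ?thesis
      using \<Sigma>(1)[of \<alpha>] by (intro exI[of _ "{x. \<alpha> \<in> \<Sigma> x}"]) (auto simp: Compl_eq)
  next
    case False
    then show ?thesis
      by (intro exI[of _ UNIV]) (auto simp: small_finite)
  qed
  then have "\<forall>\<alpha>. \<exists>S. small (- S) \<and> (\<forall>U\<in>\<C>. U \<noteq> {} \<and> e U = \<alpha> \<longrightarrow> (\<forall>x\<in>S. \<exists>f\<in>U. f x = \<alpha>))"
    by blast
  from choice[OF this] obtain S where
    "\<forall>\<alpha>. small (- S \<alpha>) \<and> (\<forall>U\<in>\<C>. U \<noteq> {} \<and> e U = \<alpha> \<longrightarrow> (\<forall>x\<in>S \<alpha>. \<exists>f\<in>U. f x = \<alpha>))" ..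
  then have S: "\<And>\<alpha>. small (- S \<alpha>)"
      "\<And>U x. U \<in> \<C> \<Longrightarrow> U \<noteq> {} \<Longrightarrow> x \<in> S (e U) \<Longrightarrow> \<exists>f\<in>U. f x = e U"
    by simp_all
  obtain \<gamma> where \<gamma>: "inj \<gamma>" "\<And>\<alpha>. \<gamma> \<alpha> \<in> S \<alpha>"
    using cosmall_transversal[of S] S(1) by blast
  let ?W = "avoiding \<gamma>"
  obtain \<U> where "\<U> \<subseteq> \<C>" "?W = \<Union>\<U>"
    using conjunct2[OF base[unfolded is_base_def], rule_format,
        OF openin_cosmall_prods[OF avoiding_in_cosmall_prods[OF \<gamma>(1)]]]
    by (elim exE conjE) (rule that)
  then obtain U where U: "U \<in> \<C>" "U \<noteq> {}" "U \<subseteq> ?W"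
    using avoiding_nonempty[OF \<gamma>(1)] by (metis Sup_upper Union_empty_conv subsetD)
  then obtain f where "f \<in> U" "f (\<gamma> (e U)) = e U"
    using S(2)[OF U(1,2) \<gamma>(2)] by blast
  with U show False
    by (auto simp: avoiding_def)
qed

section \<open>Comparison with the pointwise topology; separation and perfectness\<close>

lemma openin_pointwise_imp_cosmall:
  fixes U :: "('a \<Rightarrow> 'a) set"
  assumes "openin pointwise_top U"
  shows "openin cosmall_top U"
proof -
  have "continuous_map cosmall_top (pointwise_top :: ('a \<Rightarrow> 'a) topology) (\<lambda>f. f)"
    unfolding pointwise_top_def continuous_map_componentwise_UNIV
    using openin_cosmall_prods[OF evaluation_in_cosmall_prods]
    by (auto simp: continuous_map_def topspace_cosmall_top)
  then show ?thesis
    using openin_continuous_map_preimage assms by (fastforce simp: topspace_cosmall_top)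
qed

text \<open>A basic pointwise neighbourhood leaves some coordinate \<open>x\<close> unrestricted,
  and giving \<open>x\<close> the value \<open>x\<close> leads out of the set.\<close>

lemma not_openin_pointwise_avoiding:
  "\<not> openin (pointwise_top :: ('a \<Rightarrow> 'a) topology) (avoiding (\<lambda>\<alpha>. \<alpha>))"
proof
  let ?W = "avoiding (\<lambda>\<alpha>. \<alpha>) :: ('a \<Rightarrow> 'a) set"
  assume W: "openin pointwise_top ?W"
  obtain f where f: "f \<in> ?W"
    using avoiding_nonempty[of "\<lambda>\<alpha>. \<alpha>"] by (auto simp: inj_def)
  then obtain U where U: "finite {i. U i \<noteq> (UNIV :: 'a set)}" "\<And>i. f i \<in> U i" "Pi\<^sub>E UNIV U \<subseteq> ?W"
    using W unfolding pointwise_top_def openin_product_topology_alt by fastforce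
  obtain x where "U x = UNIV"
    using ex_new_if_finite[OF inf U(1)] by blast
  then have "f(x := x) \<in> Pi\<^sub>E UNIV U"
    using U(2) by auto
  then have "f(x := x) \<in> ?W"
    using U(3) by blast
  then show False
    by (auto simp: avoiding_def dest: spec[of _ x])
qed

lemma Hausdorff_cosmall_top: "Hausdorff_space (cosmall_top :: ('a \<Rightarrow> 'a) topology)"
proof (rule Hausdorff_space_expansive)
  show "Hausdorff_space (pointwise_top :: ('a \<Rightarrow> 'a) topology)"
    by (simp add: pointwise_top_def Hausdorff_space_product_topology Hausdorff_space_discrete_topology)
  show "topspace (pointwise_top :: ('a \<Rightarrow> 'a) topology) = topspace cosmall_top"
    by (simp add: pointwise_top_def topspace_cosmall_top)
qed (rule openin_pointwise_imp_cosmall)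

text \<open>An isolated point would force one-point factors; then no coordinate permits two distinct
  values \<open>a\<close> and \<open>b\<close>, and \<Omega> is a union of two small sets.\<close>

lemma perfect_cosmall_top: "perfect_topology (cosmall_top :: ('a \<Rightarrow> 'a) topology)"
  unfolding perfect_topology_def
proof
  assume "\<exists>f\<in>topspace cosmall_top. openin cosmall_top {f :: 'a \<Rightarrow> 'a}"
  then obtain f :: "'a \<Rightarrow> 'a" where "openin cosmall_top {f}"
    by blast
  then obtain \<Sigma> where \<Sigma>: "\<And>\<beta>. small {\<alpha>. \<beta> \<notin> \<Sigma> \<alpha>}" "f \<in> full_prod \<Sigma>" "full_prod \<Sigma> \<subseteq> {f}"
    by (rule openin_cosmall_top_basic[OF _ singletonI]) (rule that)
  have single: "\<beta> = f \<alpha>" if "\<beta> \<in> \<Sigma> \<alpha>" for \<alpha> \<beta>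
  proof -
    have "f(\<alpha> := \<beta>) \<in> full_prod \<Sigma>"
      using \<Sigma>(2) that by (auto simp: full_prod_def)
    then show ?thesis
      using \<Sigma>(3) by (auto simp: fun_upd_idem_iff)
  qed
  obtain a b :: 'a where "a \<noteq> b"
    using two_points by blast
  then have "{\<alpha>. a \<notin> \<Sigma> \<alpha>} \<union> {\<alpha>. b \<notin> \<Sigma> \<alpha>} = UNIV"
    using single by blast
  then show False
    using small_Un[OF \<Sigma>(1)[of a] \<Sigma>(1)[of b]] not_small_UNIV by simp
qed

section \<open>Dense sets\<close>

text \<open>Any function in a basic set may be changed to \<open>c\<close> wherever \<open>c\<close>
  is permitted, which is at all but few coordinates.\<close>

lemma small_support_dense:
  fixes c :: 'a
  assumes "{f. small {\<alpha>. f \<alpha> \<noteq> c}} \<subseteq> D"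
  shows "cosmall_top closure_of D = topspace cosmall_top"
  unfolding dense_intersects_open
proof (intro allI impI, elim conjE)
  fix T :: "('a \<Rightarrow> 'a) set"
  assume T: "openin cosmall_top T" "T \<noteq> {}"
  then obtain f where "f \<in> T"
    by blast
  then obtain \<Sigma> where \<Sigma>: "\<And>\<beta>. small {\<alpha>. \<beta> \<notin> \<Sigma> \<alpha>}" "f \<in> full_prod \<Sigma>" "full_prod \<Sigma> \<subseteq> T"
    by (rule openin_cosmall_top_basic[OF T(1)]) (rule that)
  let ?g = "\<lambda>\<alpha>. if c \<in> \<Sigma> \<alpha> then c else f \<alpha>"
  have "?g \<in> full_prod \<Sigma>"
    using \<Sigma>(2) by (auto simp: full_prod_def)
  moreover have "?g \<in> D"
    using assms by (force intro: small_subset[OF \<Sigma>(1)[of c]])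
  ultimately show "D \<inter> T \<noteq> {}"
    using \<Sigma>(3) by blast
qed

text \<open>A function is coded by the cardinal of its support and a map on the chosen
  representative \<open>R f\<close> of that cardinal.\<close>

lemma small_support_card_le:
  fixes c :: 'a
  shows "|{f :: 'a \<Rightarrow> 'a. small {\<alpha>. f \<alpha> \<noteq> c}}| \<le>o (sum_of_powers :: ('a set set \<times> ('a \<Rightarrow> 'a)) rel)"
proof -
  define supp where "supp f = {\<alpha>. f \<alpha> \<noteq> c}" for f :: "'a \<Rightarrow> 'a"
  define R where "R f = (SOME B. B \<in> card_class (supp f))" for f
  obtain p :: "'a \<times> 'a \<Rightarrow> 'a" where p: "inj p"
    using inj_pairing by blast
  have "\<exists>e. bij_betw e (R f) (supp f)" for f
    using card_class_some[of "supp f"] card_of_ordIso ordIso_symmetric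
    unfolding R_def by blast
  then obtain e where e: "\<And>f. bij_betw (e f) (R f) (supp f)"
    by metis
  \<comment> \<open>The bijection \<open>e f\<close> depends on \<open>f\<close>, so the point
    \<open>e f i\<close> is recorded along with the value there. Membership in \<open>Func\<close>
    demands \<open>undefined\<close> off \<open>R f\<close>.\<close>
  define h where "h f = (\<lambda>i. if i \<in> R f then p (e f i, f (e f i)) else undefined)" for f
  have "f = g" if "card_class (supp f) = card_class (supp g)" "h f = h g" for f g
  proof -
    have R: "R f = R g"
      using that(1) by (simp add: R_def)
    have eq: "e f i = e g i \<and> f (e f i) = g (e g i)" if "i \<in> R f" for i
    proof -
      have "p (e f i, f (e f i)) = p (e g i, g (e g i))"
        using fun_cong[OF \<open>h f = h g\<close>, of i] that R by (simp add: h_def)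
      from injD[OF p this] show ?thesis
        by blast
    qed
    have "supp f = e f ` R f" "supp g = e g ` R g"
      using e by (auto simp: bij_betw_def)
    moreover have "e f ` R f = e g ` R g"
      using R eq by auto
    ultimately have supp: "supp f = supp g"
      by simp
    show "f = g"
    proof
      fix x
      show "f x = g x"
      proof (cases "x \<in> supp f")
        case True
        then show ?thesis
          using \<open>supp f = e f ` R f\<close> eq by force
      next
        case False
        then show ?thesis
          using supp unfolding supp_def by (metis (mono_tags) mem_Collect_eq)
      qed
    qed
  qed
  then have "inj_on (\<lambda>f. (card_class (supp f), h f)) {f. small {\<alpha>. f \<alpha> \<noteq> c}}"
    by (auto intro!: inj_onI)
  then show ?thesis
    unfolding sum_of_powers_eq
    by (rule card_of_ordLeqI)
      (auto simp: cardinals_below_eq Func_def h_def supp_def R_def)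
qed

text \<open>The index set embeds by sending a cardinal to the two-valued indicator of its
  representative, and each summand is itself a set of functions on \<Omega>.\<close>

lemma sum_of_powers_le:
  "(sum_of_powers :: ('a set set \<times> ('a \<Rightarrow> 'a)) rel) \<le>o |UNIV :: ('a \<Rightarrow> 'a) set|"
  unfolding sum_of_powers_eq
proof (rule card_of_Sigma_ordLeq_infinite)
  obtain a b :: 'a where ab: "a \<noteq> b"
    using two_points by blast
  show "infinite (UNIV :: ('a \<Rightarrow> 'a) set)"
    using inf finite_fun_UNIVD2 by blast
  show "|cardinals_below :: 'a set set set| \<le>o |UNIV :: ('a \<Rightarrow> 'a) set|"
  proof (rule card_of_ordLeqI)
    let ?ind = "\<lambda>\<kappa> :: 'a set set. \<lambda>x. if x \<in> (SOME B. B \<in> \<kappa>) then a else b"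
    show "inj_on ?ind cardinals_below"
    proof (rule inj_onI)
      fix \<kappa> \<mu> :: "'a set set"
      assume "\<kappa> \<in> cardinals_below" "\<mu> \<in> cardinals_below" and eq: "?ind \<kappa> = ?ind \<mu>"
      then obtain A B where AB: "\<kappa> = card_class A" "\<mu> = card_class B"
        by (auto simp: cardinals_below_eq)
      have "x \<in> (SOME B. B \<in> \<kappa>) \<longleftrightarrow> x \<in> (SOME B. B \<in> \<mu>)" for x
        using fun_cong[OF eq, of x] ab by (auto split: if_splits)
      then have "(SOME B. B \<in> \<kappa>) = (SOME B. B \<in> \<mu>)"
        by blast
      then show "\<kappa> = \<mu>"
        using card_class_some[of A] card_class_some[of B] AB
        by (metis card_class_eq_iff)
    qed
  qed simp
  show "\<forall>\<kappa>\<in>(cardinals_below :: 'a set set set). |Func (SOME A. A \<in> \<kappa>) (UNIV :: 'a set)| \<le>o |UNIV :: ('a \<Rightarrow> 'a) set|"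
    by (intro ballI card_of_mono1[OF subset_UNIV])
qed

text \<open>
  Only the upper bound on the number of functions with small support is needed: the dense set of
  the exact cardinality is obtained by adding arbitrary functions.
\<close>

lemma dense_card_sum_of_powers:
  "\<exists>D :: ('a \<Rightarrow> 'a) set. |D| =o (sum_of_powers :: ('a set set \<times> ('a \<Rightarrow> 'a)) rel) \<and>
     cosmall_top closure_of D = topspace cosmall_top"
proof -
  fix c :: 'a
  let ?F = "{f :: 'a \<Rightarrow> 'a. small {\<alpha>. f \<alpha> \<noteq> c}}"
  let ?\<Sigma> = "SIGMA \<kappa> : cardinals_below. Func (SOME A. A \<in> \<kappa>) (UNIV :: 'a set)"
  obtain i :: "'a set set \<times> ('a \<Rightarrow> 'a) \<Rightarrow> 'a \<Rightarrow> 'a" where "inj_on i ?\<Sigma>"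
    using sum_of_powers_le unfolding sum_of_powers_eq by (metis card_of_ordLeq)
  then have E: "|i ` ?\<Sigma>| =o (sum_of_powers :: ('a set set \<times> ('a \<Rightarrow> 'a)) rel)"
    unfolding sum_of_powers_eq
    using card_of_ordIsoI[OF inj_on_imp_bij_betw] ordIso_symmetric by blast
  have le: "|?F| \<le>o |i ` ?\<Sigma>|"
    using small_support_card_le E ordIso_symmetric ordLeq_ordIso_trans by blast
  \<comment> \<open>This makes the image of \<open>i\<close> infinite, so adjoining
    \<open>?F\<close> does not raise its cardinality.\<close>
  have "infinite ?F"
  proof
    assume "finite ?F"
    moreover have "range (\<lambda>x. (\<lambda>_. c)(c := x)) \<subseteq> ?F"
      by (auto intro!: small_subset[OF small_finite[of "{c}"]] split: if_splits)
    moreover have "inj (\<lambda>x. (\<lambda>_. c)(c := x))"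
      by (auto simp: inj_def fun_eq_iff split: if_splits)
    ultimately show False
      using inf finite_subset finite_imageD by blast
  qed
  then have "infinite (i ` ?\<Sigma>)"
    using le card_of_ordLeq_infinite by blast
  then have "|i ` ?\<Sigma> \<union> ?F| \<le>o |i ` ?\<Sigma>|"
    using le by (intro card_of_Un_ordLeq_infinite_Field) (simp_all add: card_of_card_order_on Field_card_of card_of_mono1)
  then have "|i ` ?\<Sigma> \<union> ?F| =o |i ` ?\<Sigma>|"
    by (simp add: ordIso_iff_ordLeq card_of_mono1)
  then have "|i ` ?\<Sigma> \<union> ?F| =o (sum_of_powers :: ('a set set \<times> ('a \<Rightarrow> 'a)) rel)"
    using E ordIso_transitive by blast
  moreover have "cosmall_top closure_of (i ` ?\<Sigma> \<union> ?F) = topspace cosmall_top"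
    by (rule small_support_dense[of c]) blast
  ultimately show ?thesis
    by blast
qed

lemma small_countable_finite:
  fixes A :: "'a set"
  assumes "countable (UNIV :: 'a set)" "small A"
  shows "finite A"
proof (rule ccontr)
  assume "infinite A"
  then have "|UNIV :: 'a set| \<le>o |A|"
    using ordLeq_transitive[OF iffD1[OF countable_card_of_nat assms(1)]]
      iffD1[OF infinite_iff_card_of_nat] by blast
  then show False
    using assms(2) not_ordLess_ordLeq by blast
qed

text \<open>Small now means finite, so a function in \<open>?F\<close> is determined by the finite
  part of its graph where the value is not \<open>c\<close>.\<close>

lemma separable_cosmall_top:
  assumes "countable (UNIV :: 'a set)"
  shows "separable_space (cosmall_top :: ('a \<Rightarrow> 'a) topology)"
proof -
  fix c :: 'a
  let ?F = "{f :: 'a \<Rightarrow> 'a. small {\<alpha>. f \<alpha> \<noteq> c}}"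
  let ?G = "\<lambda>f :: 'a \<Rightarrow> 'a. (\<lambda>\<alpha>. (\<alpha>, f \<alpha>)) ` {\<alpha>. f \<alpha> \<noteq> c}"
  have inj: "inj ?G"
  proof (rule injI, rule ext)
    fix f g x
    assume eq: "?G f = ?G g"
    have "(x, y) \<in> ?G f \<longleftrightarrow> y = f x \<and> y \<noteq> c" "(x, y) \<in> ?G g \<longleftrightarrow> y = g x \<and> y \<noteq> c" for y
      by auto
    then show "f x = g x"
      using eq by metis
  qed
  have "countable (UNIV :: ('a \<times> 'a) set)"
    using assms countable_SIGMA[of UNIV "\<lambda>_. UNIV"] by (simp add: UNIV_Times_UNIV)
  then have "countable {A :: ('a \<times> 'a) set. finite A}"
    using countable_Collect_finite_subset by fastforce
  then have "countable (?G ` ?F)"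
    by (rule countable_subset[rotated]) (auto dest: small_countable_finite[OF assms])
  then have "countable ?F"
    by (rule countable_image_inj_on) (rule inj_on_subset[OF inj subset_UNIV])
  then show ?thesis
    unfolding separable_space_def topspace_cosmall_top
    using small_support_dense[of c ?F] topspace_cosmall_top by auto
qed

section \<open>Compact sets\<close>

text \<open>
  The sets \<open>{f. f (\<gamma> \<alpha>) = \<alpha>}\<close> together with \<open>avoiding \<gamma>\<close> cover everything, and for a suitable
  \<open>\<gamma>\<close> no finite subfamily covers the given basic set.
\<close>

lemma basic_not_in_compact:
  fixes U :: "('a \<Rightarrow> 'a) set"
  assumes "U \<in> cosmall_prods" "U \<noteq> {}" "compactin cosmall_top K"
  shows "\<not> U \<subseteq> K"
proof
  assume "U \<subseteq> K"
  obtain \<Sigma> where \<Sigma>: "U = full_prod \<Sigma>" "\<And>\<beta>. small {\<alpha>. \<beta> \<notin> \<Sigma> \<alpha>}"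
    using assms(1) by (metis cosmall_prodsE)
  obtain f where f: "\<And>\<alpha>. f \<alpha> \<in> \<Sigma> \<alpha>"
    using assms(2) \<Sigma>(1) by (auto simp: full_prod_def)
  obtain a b :: 'a where "a \<noteq> b"
    using two_points by blast
  \<comment> \<open>The factor at \<open>\<gamma> \<alpha>\<close> must permit \<alpha> in order to
    leave \<open>avoiding \<gamma>\<close>, and \<open>a\<close> and \<open>b\<close> in order to
    escape the other covering sets.\<close>
  have "small (- {x. \<alpha> \<in> \<Sigma> x \<and> a \<in> \<Sigma> x \<and> b \<in> \<Sigma> x})" for \<alpha>
    by (rule small_subset[OF small_Un[OF \<Sigma>(2)[of \<alpha>] small_Un[OF \<Sigma>(2)[of a] \<Sigma>(2)[of b]]]]) auto
  then obtain \<gamma> where \<gamma>: "inj \<gamma>" "\<And>\<alpha>. \<gamma> \<alpha> \<in> {x. \<alpha> \<in> \<Sigma> x \<and> a \<in> \<Sigma> x \<and> b \<in> \<Sigma> x}"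
    using cosmall_transversal[of "\<lambda>\<alpha>. {x. \<alpha> \<in> \<Sigma> x \<and> a \<in> \<Sigma> x \<and> b \<in> \<Sigma> x}"] by blast
  let ?W = "avoiding \<gamma>" and ?V = "\<lambda>\<alpha>. {f. f (\<gamma> \<alpha>) \<in> {\<alpha>}}"
  have "openin cosmall_top V" if "V \<in> insert ?W (range ?V)" for V
    using that
  proof
    assume "V = ?W"
    then show ?thesis
      using openin_cosmall_prods[OF avoiding_in_cosmall_prods[OF \<gamma>(1)]] by simp
  next
    assume "V \<in> range ?V"
    then obtain \<alpha> where "V = ?V \<alpha>" ..
    then show ?thesis
      using openin_cosmall_prods[OF evaluation_in_cosmall_prods[of "\<gamma> \<alpha>" "{\<alpha>}"]] by simp
  qed
  moreover have "K \<subseteq> \<Union>(insert ?W (range ?V))"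
    by (auto simp: avoiding_def)
  ultimately obtain \<F> where \<F>: "finite \<F>" "\<F> \<subseteq> insert ?W (range ?V)" "K \<subseteq> \<Union>\<F>"
    using assms(3) unfolding compactin_def by meson
  then have "\<F> - {?W} \<subseteq> range ?V"
    by blast
  from finite_subset_image[OF finite_Diff[OF \<F>(1)] this]
  obtain A where A: "finite A" "\<F> - {?W} = ?V ` A"
    by (elim exE conjE) (rule that)
  obtain \<alpha> where \<alpha>: "\<alpha> \<notin> A"
    using ex_new_if_finite[OF inf A(1)] by blast
  \<comment> \<open>For \<beta> other than \<alpha>, the value at \<open>\<gamma> \<beta>\<close>
    differs from \<beta>: it is \<open>b\<close> if \<beta> is \<open>a\<close>, and
    \<open>a\<close> otherwise.\<close>
  define g where "g x = (if x = \<gamma> \<alpha> then \<alpha> else if x \<in> range \<gamma> then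
      (if x = \<gamma> a then b else a) else f x)" for x
  have "g \<in> U"
    using f \<gamma>(2) \<Sigma>(1) by (auto simp: g_def full_prod_def)
  moreover have "g \<notin> ?W"
  proof -
    have "g (\<gamma> \<alpha>) = \<alpha>"
      by (simp add: g_def)
    then show ?thesis
      unfolding avoiding_def by blast
  qed
  moreover have "g \<notin> ?V \<beta>" if "\<beta> \<in> A" for \<beta>
  proof -
    have "\<gamma> \<beta> \<noteq> \<gamma> \<alpha>" "\<gamma> \<beta> = \<gamma> a \<longleftrightarrow> \<beta> = a"
      using \<gamma>(1) \<alpha> that by (auto simp: inj_def)
    then show ?thesis
      using \<open>a \<noteq> b\<close> by (auto simp: g_def)
  qed
  ultimately show False
    using \<open>U \<subseteq> K\<close> \<F>(3) A(2) by blast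
qed

section \<open>Continuity of composition\<close>

text \<open>Strict initial segments of the cardinal well-order work: those omitting \<delta> belong
  to points at or below \<delta>.\<close>

lemma small_initial_segments:
  obtains I :: "'a \<Rightarrow> 'a set"
  where "\<And>\<beta>. small (I \<beta>)" "\<And>\<delta>. small {\<beta>. \<delta> \<notin> I \<beta>}"
proof
  let ?r = "|UNIV :: 'a set|"
  have wo: "Well_order ?r" and Field: "Field ?r = UNIV"
    by (simp_all add: card_of_well_order_on Field_card_of)
  show small: "small (underS ?r \<beta>)" for \<beta>
    by (rule card_of_underS) (simp_all add: card_of_card_order_on Field)
  have "{\<beta>. \<delta> \<notin> underS ?r \<beta>} \<subseteq> insert \<delta> (underS ?r \<delta>)" for \<delta>
    using wo Field unfolding well_order_on_def linear_order_on_def total_on_def underS_def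
    by auto
  then show "small {\<beta>. \<delta> \<notin> underS ?r \<beta>}" for \<delta>
    using small_Un[OF small_finite[of "{\<delta>}"] small] small_subset by (metis finite.simps insert_is_Un)
qed

text \<open>
  With \<open>(\<alpha>)fg \<in> \<Sigma>\<^sub>\<alpha>\<close>, shrink the initial segments to sets \<open>\<Gamma> \<beta>\<close> contained in \<open>\<Sigma> \<alpha>\<close> for every
  \<open>\<alpha>\<close> in the fibre of \<open>f\<close> over \<open>\<beta>\<close>, and let \<open>\<Lambda> \<alpha>\<close> consist of all \<open>\<beta>\<close> with \<open>\<Gamma> \<beta> \<subseteq> \<Sigma> \<alpha>\<close>.  Regularity
  is used to see that \<open>\<beta> \<in> \<Lambda> \<alpha>\<close> for all but few \<open>\<alpha>\<close>.
\<close>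

lemma comp_neighbourhoods:
  fixes f g :: "'a \<Rightarrow> 'a"
  assumes reg: "regularCard |UNIV :: 'a set|"
    and \<Sigma>: "\<And>\<beta>. small {\<alpha>. \<beta> \<notin> \<Sigma> \<alpha>}" "g \<circ> f \<in> full_prod \<Sigma>"
  obtains U V where "U \<in> cosmall_prods" "V \<in> cosmall_prods" "f \<in> U" "g \<in> V"
    "\<And>u v. u \<in> U \<Longrightarrow> v \<in> V \<Longrightarrow> v \<circ> u \<in> full_prod \<Sigma>"
proof -
  obtain I :: "'a \<Rightarrow> 'a set" where I: "\<And>\<beta>. small (I \<beta>)" "\<And>\<delta>. small {\<beta>. \<delta> \<notin> I \<beta>}"
    by (rule small_initial_segments) (rule that)
  \<comment> \<open>Inserting \<open>g \<beta>\<close> puts \<open>g\<close> in the product of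
    \<open>\<Gamma>\<close>; it keeps \<open>\<Gamma> (f \<alpha>)\<close> inside
    \<open>\<Sigma> \<alpha>\<close> because \<open>g (f \<alpha>)\<close> lies there.\<close>
  define \<Gamma> where "\<Gamma> \<beta> = insert (g \<beta>) {\<delta> \<in> I \<beta>. \<forall>\<alpha>. f \<alpha> = \<beta> \<longrightarrow> \<delta> \<in> \<Sigma> \<alpha>}" for \<beta>
  define \<Lambda> where "\<Lambda> \<alpha> = {\<beta>. \<Gamma> \<beta> \<subseteq> \<Sigma> \<alpha>}" for \<alpha>
  \<comment> \<open>A \<beta> that loses \<delta> either has \<delta> outside
    \<open>I \<beta>\<close> or is the image under \<open>f\<close> of one of the few \<alpha> whose
    factor omits \<delta>.\<close>
  have "small {\<beta>. \<delta> \<notin> \<Gamma> \<beta>}" for \<delta>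
    by (rule small_subset[OF small_Un[OF I(2)[of \<delta>] small_image[OF \<Sigma>(1)[of \<delta>], of f]]])
      (auto simp: \<Gamma>_def)
  then have V: "full_prod \<Gamma> \<in> cosmall_prods"
    using cosmall_prodsI by blast
  have "small {\<alpha>. \<beta> \<notin> \<Lambda> \<alpha>}" for \<beta>
  proof -
    have "small (\<Gamma> \<beta>)"
      by (rule small_subset[OF small_Un[OF small_finite[of "{g \<beta>}"] I(1)[of \<beta>]]]) (auto simp: \<Gamma>_def)
    moreover have "stable |UNIV :: 'a set|"
      using reg inf by (intro regularCard_stable) (auto simp: card_of_card_order_on Field_card_of)
    ultimately have "small (\<Union>\<delta>\<in>\<Gamma> \<beta>. {\<alpha>. \<delta> \<notin> \<Sigma> \<alpha>})"
      using \<Sigma>(1) by (intro stable_UNION)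
    then show ?thesis
      by (rule small_subset) (auto simp: \<Lambda>_def)
  qed
  then have U: "full_prod \<Lambda> \<in> cosmall_prods"
    using cosmall_prodsI by blast
  have "f \<in> full_prod \<Lambda>" "g \<in> full_prod \<Gamma>"
    using \<Sigma>(2) by (auto simp: full_prod_def \<Lambda>_def \<Gamma>_def)
  moreover have "v \<circ> u \<in> full_prod \<Sigma>" if "u \<in> full_prod \<Lambda>" "v \<in> full_prod \<Gamma>" for u v
    using that by (auto simp: full_prod_def \<Lambda>_def)
  ultimately show thesis
    using that U V by blast
qed

lemma topological_semigroup_cosmall_top:
  assumes "regularCard |UNIV :: 'a set|"
  shows "topological_semigroup (cosmall_top :: ('a \<Rightarrow> 'a) topology) right_comp"
  unfolding topological_semigroup_def
proof (intro conjI)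
  let ?T = "cosmall_top :: ('a \<Rightarrow> 'a) topology"
  show "continuous_map (prod_topology ?T ?T) ?T (\<lambda>(x, y). right_comp x y)"
    unfolding continuous_map_def
  proof (intro conjI allI impI)
    fix W :: "('a \<Rightarrow> 'a) set"
    assume W: "openin ?T W"
    show "openin (prod_topology ?T ?T)
        {x \<in> topspace (prod_topology ?T ?T). (case x of (x, y) \<Rightarrow> right_comp x y) \<in> W}"
      unfolding openin_prod_topology_alt
    proof (intro allI impI)
      fix f g :: "'a \<Rightarrow> 'a"
      assume "(f, g) \<in> {x \<in> topspace (prod_topology ?T ?T). (case x of (x, y) \<Rightarrow> right_comp x y) \<in> W}"
      then have "g \<circ> f \<in> W"
        by (simp add: right_comp_def)
      then obtain \<Sigma> where \<Sigma>: "\<And>\<beta>. small {\<alpha>. \<beta> \<notin> \<Sigma> \<alpha>}" "g \<circ> f \<in> full_prod \<Sigma>" "full_prod \<Sigma> \<subseteq> W"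
        by (rule openin_cosmall_top_basic[OF W]) (rule that)
      obtain U V where UV: "U \<in> cosmall_prods" "V \<in> cosmall_prods" "f \<in> U" "g \<in> V"
          "\<And>u v. u \<in> U \<Longrightarrow> v \<in> V \<Longrightarrow> v \<circ> u \<in> full_prod \<Sigma>"
        by (rule comp_neighbourhoods[OF assms \<Sigma>(1,2)]) (rule that)
      then have "U \<times> V \<subseteq>
          {x \<in> topspace (prod_topology ?T ?T). (case x of (x, y) \<Rightarrow> right_comp x y) \<in> W}"
        using \<Sigma>(3) by (auto simp: right_comp_def topspace_cosmall_top)
      then show "\<exists>U V. openin ?T U \<and> openin ?T V \<and> f \<in> U \<and> g \<in> V \<and> U \<times> V \<subseteq>
          {x \<in> topspace (prod_topology ?T ?T). (case x of (x, y) \<Rightarrow> right_comp x y) \<in> W}"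
        using UV(3,4) openin_cosmall_prods[OF UV(1)] openin_cosmall_prods[OF UV(2)] by blast
    qed
  qed (simp add: topspace_cosmall_top)
qed (auto simp: topspace_cosmall_top right_comp_def)

end

theorem proposition5p1:
  assumes inf: "infinite (UNIV :: 'a set)"
  shows
    "((\<forall>\<F> :: ('a \<Rightarrow> 'a) set set. finite \<F> \<and> \<F> \<subseteq> cosmall_prods \<longrightarrow> \<Inter>\<F> \<in> cosmall_prods) \<and>
      is_base (cosmall_top :: ('a \<Rightarrow> 'a) topology) cosmall_prods) \<and>
     (\<forall>\<C>. is_base (cosmall_top :: ('a \<Rightarrow> 'a) topology) \<C> \<longrightarrow> |UNIV :: 'a set| <o |\<C>| ) \<and>
     ((\<forall>U. openin (pointwise_top :: ('a \<Rightarrow> 'a) topology) U \<longrightarrow> openin cosmall_top U) \<and>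
      (\<exists>U. openin (cosmall_top :: ('a \<Rightarrow> 'a) topology) U \<and> \<not> openin pointwise_top U) \<and>
      Hausdorff_space (cosmall_top :: ('a \<Rightarrow> 'a) topology)) \<and>
     perfect_topology (cosmall_top :: ('a \<Rightarrow> 'a) topology) \<and>
     ((\<exists>D :: ('a \<Rightarrow> 'a) set.
         |D| =o (sum_of_powers :: ('a set set \<times> ('a \<Rightarrow> 'a)) rel) \<and>
         cosmall_top closure_of D = topspace cosmall_top) \<and>
      (countable (UNIV :: 'a set) \<longrightarrow> separable_space (cosmall_top :: ('a \<Rightarrow> 'a) topology))) \<and>
     (\<forall>U \<in> (cosmall_prods :: ('a \<Rightarrow> 'a) set set).
        U \<noteq> {} \<longrightarrow> \<not> (\<exists>K. compactin cosmall_top K \<and> U \<subseteq> K)) \<and>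
     (regularCard |UNIV :: 'a set| \<longrightarrow>
        topological_semigroup (cosmall_top :: ('a \<Rightarrow> 'a) topology) right_comp)"
proof -
  note avoiding = avoiding_in_cosmall_prods[OF inf, of "\<lambda>\<alpha>. \<alpha>"]
  have "\<exists>U. openin (cosmall_top :: ('a \<Rightarrow> 'a) topology) U \<and> \<not> openin pointwise_top U"
    using openin_cosmall_prods[OF avoiding] not_openin_pointwise_avoiding[OF inf]
    by (auto simp: inj_def)
  moreover have "\<forall>U \<in> (cosmall_prods :: ('a \<Rightarrow> 'a) set set).
      U \<noteq> {} \<longrightarrow> \<not> (\<exists>K. compactin cosmall_top K \<and> U \<subseteq> K)"
    using basic_not_in_compact[OF inf] by blast
  ultimately show ?thesis
    using cosmall_prods_Inter[OF inf] is_base_cosmall_prods[OF inf] base_card_gt[OF inf]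
      openin_pointwise_imp_cosmall[OF inf] Hausdorff_cosmall_top[OF inf] perfect_cosmall_top[OF inf]
      dense_card_sum_of_powers[OF inf] separable_cosmall_top[OF inf]
      topological_semigroup_cosmall_top[OF inf]
    by (intro conjI allI impI) simp_all
qed

end
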